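(* Let $G$ be a connected Hausdorff topological group. Let $A$ be a C*-algebra with the ideal property. Suppose there exists a minimal (continuous) action $\alpha \colon G \to \mathrm{Aut}(A)$. Then $A$ is simple.
   Context: A C*-algebra $A$ has the ideal property if every closed two-sided ideal in $A$ is generated, as a closed ideal, by the projections it contains. An action of a topological group $G$ on $A$ is a homomorphism $\alpha \colon G \to \mathrm{Aut}(A)$ such that $g \mapsto \alpha_g(a)$ is norm continuous for all $a \in A$. The action is minimal if the only $\alpha$-invariant closed two-sided ideals of $A$ are $0$ and $A$. *)

theory Defs
  imports "HOL-Analysis.Analysis"
begin

(* Complex C*-algebras, not assumed unital and possibly zero.  The parent class
   real_normed_algebra supplies norm (x * y) \<le> norm x * norm y, and scaleR_scaleC makes its
   real scalar multiplication the restriction of the complex one. *)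
class cstar_algebra = banach + real_normed_algebra +
  fixes scaleC :: "complex \<Rightarrow> 'a \<Rightarrow> 'a"  (infixr "*\<^sub>C" 75)
    and star :: "'a \<Rightarrow> 'a"
  assumes scaleC_add_right: "c *\<^sub>C (x + y) = c *\<^sub>C x + c *\<^sub>C y"
    and scaleC_add_left: "(c + d) *\<^sub>C x = c *\<^sub>C x + d *\<^sub>C x"
    and scaleC_scaleC: "c *\<^sub>C d *\<^sub>C x = (c * d) *\<^sub>C x"
    and scaleR_scaleC: "scaleR r x = complex_of_real r *\<^sub>C x"
    and norm_scaleC: "norm (c *\<^sub>C x) = cmod c * norm x"
    and scaleC_mult_left: "(c *\<^sub>C x) * y = c *\<^sub>C (x * y)"
    and scaleC_mult_right: "x * (c *\<^sub>C y) = c *\<^sub>C (x * y)"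
    and star_add: "star (x + y) = star x + star y"
    and star_scaleC: "star (c *\<^sub>C x) = cnj c *\<^sub>C star x"
    and star_mult: "star (x * y) = star y * star x"
    and star_star: "star (star x) = x"
    and cstar_identity: "norm (star x * x) = (norm x)\<^sup>2"

instantiation complex :: cstar_algebra
begin

definition scaleC_complex :: "complex \<Rightarrow> complex \<Rightarrow> complex"
  where "scaleC_complex c x = c * x"

definition star_complex :: "complex \<Rightarrow> complex"
  where "star_complex x = cnj x"

instance
  by standard
    (simp_all add: scaleC_complex_def star_complex_def algebra_simps norm_mult
      scaleR_conv_of_real power2_eq_square)

end

definition closed_ideal :: "'a::cstar_algebra set \<Rightarrow> bool"
  where "closed_ideal I \<longleftrightarrow>
    closed I \<and> 0 \<in> I \<and>
    (\<forall>x\<in>I. \<forall>y\<in>I. x + y \<in> I) \<and>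
    (\<forall>c. \<forall>x\<in>I. c *\<^sub>C x \<in> I) \<and>
    (\<forall>a. \<forall>x\<in>I. a * x \<in> I \<and> x * a \<in> I)"

definition closed_ideal_generated :: "'a::cstar_algebra set \<Rightarrow> 'a set"
  where "closed_ideal_generated S = \<Inter>{J. closed_ideal J \<and> S \<subseteq> J}"

definition projection :: "'a::cstar_algebra \<Rightarrow> bool"
  where "projection p \<longleftrightarrow> p * p = p \<and> star p = p"

(* The properties below belong to a C*-algebra as a whole; since the algebra is a type,
   they take it as an itself argument, TYPE('a). *)
definition ideal_property :: "'a::cstar_algebra itself \<Rightarrow> bool"
  where "ideal_property A \<longleftrightarrow>
    (\<forall>I::'a set. closed_ideal I \<longrightarrow> I = closed_ideal_generated {p \<in> I. projection p})"

(* The zero algebra counts as simple, just as its trivial action counts as minimal below. *)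
definition simple_cstar :: "'a::cstar_algebra itself \<Rightarrow> bool"
  where "simple_cstar A \<longleftrightarrow> (\<forall>I::'a set. closed_ideal I \<longrightarrow> I = {0} \<or> I = UNIV)"

definition star_automorphism :: "('a::cstar_algebra \<Rightarrow> 'a) \<Rightarrow> bool"
  where "star_automorphism \<phi> \<longleftrightarrow>
    bij \<phi> \<and>
    (\<forall>x y. \<phi> (x + y) = \<phi> x + \<phi> y) \<and>
    (\<forall>c x. \<phi> (c *\<^sub>C x) = c *\<^sub>C \<phi> x) \<and>
    (\<forall>x y. \<phi> (x * y) = \<phi> x * \<phi> y) \<and>
    (\<forall>x. \<phi> (star x) = star (\<phi> x))"

(* topological_group_add is the class of topological groups that need be neither commutative
   nor Hausdorff; the group operation is written + although it is arbitrary. *)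
definition continuous_action ::
    "('g::topological_group_add \<Rightarrow> 'a::cstar_algebra \<Rightarrow> 'a) \<Rightarrow> bool"
  where "continuous_action \<alpha> \<longleftrightarrow>
    (\<forall>g. star_automorphism (\<alpha> g)) \<and>
    (\<forall>g h. \<alpha> (g + h) = \<alpha> g \<circ> \<alpha> h) \<and>
    (\<forall>a. continuous_on UNIV (\<lambda>g. \<alpha> g a))"

definition minimal_action :: "('g \<Rightarrow> 'a::cstar_algebra \<Rightarrow> 'a) \<Rightarrow> bool"
  where "minimal_action \<alpha> \<longleftrightarrow>
    (\<forall>I. closed_ideal I \<and> (\<forall>g. \<alpha> g ` I \<subseteq> I) \<longrightarrow> I = {0} \<or> I = UNIV)"

end

theory Submission
  imports Defs
begin

text \<open>
  Let \<open>I\<close> be a closed ideal. Two idempotents at distance less than \<open>1\<close> lie in the same closed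
  ideals (\<open>idempotent_in_ideal_if_close\<close>), so for a projection \<open>p\<close> in \<open>I\<close> the set of all \<open>g\<close>
  with \<open>\<alpha> g p \<in> I\<close> is open. It is closed because \<open>I\<close> is, and it contains \<open>0\<close>; as the group is
  connected, the whole orbit of \<open>p\<close> stays in \<open>I\<close> (\<open>orbit_of_idempotent_in_ideal\<close>). By the ideal
  property the projections of \<open>I\<close> generate it, so \<open>\<alpha> g\<close> maps \<open>I\<close> into itself for every \<open>g\<close>.
  Thus every closed ideal is invariant, and minimality leaves only \<open>0\<close> and the whole algebra.

  Passing from the projections to the closed ideal that they generate uses that each \<open>\<alpha> g\<close>, which
  is given as a purely algebraic automorphism, is norm continuous. The classical argument compares
  spectral radii. Here a self-adjoint strict contraction \<open>a\<close> is completed to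
  \<open>a\<^sup>2 + s\<^sup>2 = 1\<close> with a commuting self-adjoint \<open>s\<close>. Such an equation survives every
  *-homomorphism, and it bounds the norm, because \<open>a\<close> is then the real part of the unitary
  \<open>a + \<i> s\<close>. So automorphisms do not increase norms (\<open>star_automorphism_norm_le\<close>). As the algebra
  may lack a unit, \<open>s\<close> is written as \<open>1 - d\<close>, and the equation becomes \<open>d + d = a\<^sup>2 + d\<^sup>2\<close>.
\<close>

section \<open>Elementary identities\<close>

lemma scaleC_minus1: "(-1) *\<^sub>C x = - (x::'a::cstar_algebra)"
  using scaleR_scaleC[of "-1" x] by simp

lemma scaleC_minus_left: "(- c) *\<^sub>C x = - (c *\<^sub>C (x::'a::cstar_algebra))"
  by (metis mult_minus1 scaleC_minus1 scaleC_scaleC)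

lemma scaleC_minus_right: "c *\<^sub>C (- x) = - (c *\<^sub>C (x::'a::cstar_algebra))"
  by (metis mult.commute scaleC_minus1 scaleC_scaleC)

lemma scaleC_diff_right: "c *\<^sub>C (x - y) = c *\<^sub>C x - c *\<^sub>C (y::'a::cstar_algebra)"
  by (metis diff_conv_add_uminus scaleC_add_right scaleC_minus_right)

lemma star_minus: "star (- x) = - star (x::'a::cstar_algebra)"
  by (metis complex_cnj_minus complex_cnj_one scaleC_minus1 star_scaleC)

lemma star_diff: "star (x - y) = star x - star (y::'a::cstar_algebra)"
  by (metis diff_conv_add_uminus star_add star_minus)

lemma star_scaleR: "star (r *\<^sub>R x) = r *\<^sub>R star (x::'a::cstar_algebra)"
  by (simp add: scaleR_scaleC star_scaleC)

lemma norm_star: "norm (star x) = norm (x::'a::cstar_algebra)"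
proof -
  have le: "norm y \<le> norm (star y)" for y :: 'a
  proof (cases "y = 0")
    case False
    have "norm y * norm y \<le> norm (star y) * norm y"
      using cstar_identity[of y] norm_mult_ineq[of "star y" y] by (simp add: power2_eq_square)
    then show ?thesis using False by simp
  qed simp
  show ?thesis using le[of x] le[of "star x"] by (simp add: star_star)
qed

lemma continuous_on_star: "continuous_on S (star :: 'a::cstar_algebra \<Rightarrow> 'a)"
proof (rule continuous_on_iff[THEN iffD2], intro ballI allI impI)
  fix x :: 'a and e :: real assume "0 < e"
  then show "\<exists>d>0. \<forall>x'\<in>S. dist x' x < d \<longrightarrow> dist (star x') (star x) < e"
    by (intro exI[of _ e]) (simp add: dist_norm norm_star flip: star_diff)
qed

section \<open>Automorphisms are continuous\<close>

text \<open>
  The element \<open>1 - d\<close> is a square root of \<open>1 - a\<^sup>2\<close>. The equation says that \<open>d\<close> is a fixed point of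
  \<open>d \<mapsto> (a\<^sup>2 + d\<^sup>2) / 2\<close>, which contracts the ball of radius \<open>\<parallel>a\<^sup>2\<parallel> < 1\<close>. Self-adjointness and
  commutation with \<open>a\<close> are closed conditions that this map preserves, so they can be built into
  the space on which the fixed point is sought.
\<close>

lemma selfadjoint_cosine_has_sine:
  fixes a :: "'a::cstar_algebra"
  assumes "star a = a" and "norm a < 1"
  obtains d where "star d = d" and "d * a = a * d" and "d + d = a * a + d * d"
proof -
  define r where "r = norm (a * a)"
  define S where "S = {d. norm d \<le> r} \<inter> {d. star d = d} \<inter> {d. d * a = a * d}"
  define f where "f d = (1/2::real) *\<^sub>R (a * a + d * d)" for d
  have r0: "0 \<le> r" by (simp add: r_def)
  have r1: "r < 1"
    using cstar_identity[of a] assms by (simp add: r_def power_less_one_iff)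
  have "closed S"
    unfolding S_def
    by (intro closed_Int closed_Collect_le closed_Collect_eq continuous_intros continuous_on_star)
  then have "complete S"
    by (simp add: complete_eq_closed)
  moreover have "0 \<in> S"
    using r0 star_diff[of "0::'a" 0] by (simp add: S_def)
  then have "S \<noteq> {}" by blast
  moreover have "f ` S \<subseteq> S"
  proof (rule image_subsetI)
    fix d assume d: "d \<in> S"
    have "norm (d * d) \<le> r * r"
      using d by (intro order_trans[OF norm_mult_ineq] mult_mono) (auto simp: S_def r0)
    also have "\<dots> \<le> r" using r0 r1 by (simp add: mult_left_le)
    finally have "norm (a * a + d * d) \<le> r + r"
      by (intro order_trans[OF norm_triangle_ineq] add_mono) (simp_all add: r_def)
    then have "norm (f d) \<le> r" by (simp add: f_def)
    moreover have "star (f d) = f d"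
      using d assms(1) by (simp add: S_def f_def star_scaleR star_add star_mult)
    moreover have "d * d * a = a * (d * d)"
      using d by (simp add: S_def) (metis mult.assoc)
    then have "f d * a = a * f d"
      by (simp add: f_def algebra_simps)
    ultimately show "f d \<in> S" by (simp add: S_def)
  qed
  moreover have "dist (f x) (f y) \<le> r * dist x y" if "x \<in> S" "y \<in> S" for x y
  proof -
    have "f x - f y = (1/2::real) *\<^sub>R (x * (x - y) + (x - y) * y)"
      by (simp add: f_def algebra_simps)
    moreover have "norm (x * (x - y) + (x - y) * y) \<le> r * norm (x - y) + norm (x - y) * r"
      using that
      by (intro order_trans[OF norm_triangle_ineq] add_mono
          order_trans[OF norm_mult_ineq] mult_mono) (auto simp: S_def r0)
    ultimately show ?thesis by (simp add: dist_norm)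
  qed
  ultimately obtain d where d: "d \<in> S" "f d = d"
    using r0 r1 Banach_fix[of S r f] by blast
  have "d + d = 2 *\<^sub>R f d" using d(2) by (simp add: scaleR_2)
  then have "d + d = a * a + d * d" by (simp add: f_def)
  with d(1) show thesis by (intro that[of d]) (simp_all add: S_def)
qed

text \<open>
  In a unital algebra \<open>b \<plusminus> \<i> (1 - e)\<close> would be unitaries with mean \<open>b\<close>. Without a unit, left
  multiplication by them still makes sense and is isometric, since
  \<open>(b - \<i> (1 - e)) (b + \<i> (1 - e)) = b\<^sup>2 + (1 - e)\<^sup>2 = 1\<close>. Hence multiplication by \<open>b\<close> is
  contractive, and applying it to \<open>b\<close> itself gives \<open>\<parallel>b\<parallel>\<^sup>2 \<le> \<parallel>b\<parallel>\<close>.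
\<close>

lemma norm_le_one_if_sine:
  fixes b e :: "'a::cstar_algebra"
  assumes b: "star b = b" and e: "star e = e" and comm: "e * b = b * e"
    and sq: "e + e = b * b + e * e"
  shows "norm b \<le> 1"
proof -
  have iso: "norm (b * x + c *\<^sub>C (x - e * x)) = norm x" if c: "c = \<i> \<or> c = - \<i>" for c x
  proof -
    define y where "y = x - e * x"
    have cc: "cnj c = - c" "c * c = -1" using c by auto
    have sy: "star y = star x - star x * e"
      by (simp add: y_def star_diff star_mult e)
    have cross: "star x * (b * y) = star y * (b * x)"
    proof -
      have "b * (e * x) = e * (b * x)" by (simp add: comm flip: mult.assoc)
      then show ?thesis
        by (simp only: sy) (simp add: y_def right_diff_distrib left_diff_distrib mult.assoc)
    qed
    have "star (b * x + c *\<^sub>C y) * (b * x + c *\<^sub>C y)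
        = (star x * b - c *\<^sub>C star y) * (b * x + c *\<^sub>C y)"
      by (simp add: star_add star_mult star_scaleC b cc scaleC_minus_left)
    \<comment> \<open>The cross terms cancel because \<open>e\<close> commutes with \<open>b\<close>.\<close>
    also have "\<dots> = star x * (b * (b * x)) + star y * y"
      by (simp add: left_diff_distrib distrib_left scaleC_mult_left scaleC_mult_right
          mult.assoc cross scaleC_diff_right scaleC_scaleC cc scaleC_minus1)
    also have "\<dots> = star x * x + star x * ((b * b + e * e) - (e + e)) * x"
      by (simp only: sy) (simp add: y_def algebra_simps)
    also have "\<dots> = star x * x" by (simp add: sq)
    finally show ?thesis
      unfolding y_def by (metis cstar_identity norm_ge_zero power2_eq_iff_nonneg)
  qed
  have "norm (b * b) \<le> norm b"
  proof -
    let ?s = "\<i> *\<^sub>C (b - e * b)"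
    have n: "norm (b * b + ?s) = norm b" "norm (b * b - ?s) = norm b"
      using iso[of \<i> b] iso[of "- \<i>" b] by (simp_all add: scaleC_minus_left)
    have "2 *\<^sub>R (b * b) = (b * b + ?s) + (b * b - ?s)"
      by (simp add: scaleR_2)
    then have "2 * norm (b * b) \<le> norm b + norm b"
      by (metis n norm_scaleR norm_triangle_ineq abs_numeral)
    then show ?thesis by simp
  qed
  moreover have "norm (b * b) = norm b * norm b"
    using cstar_identity[of b] b by (simp add: power2_eq_square)
  ultimately show ?thesis
    by (cases "b = 0") auto
qed

text \<open>
  The two preceding lemmas bound the image of a self-adjoint strict contraction; scaling gives
  all self-adjoint elements, and the C*-identity reduces \<open>x\<close> to \<open>star x * x\<close>.
\<close>

lemma star_automorphism_norm_le:
  fixes \<phi> :: "'a::cstar_algebra \<Rightarrow> 'a"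
  assumes "star_automorphism \<phi>"
  shows "norm (\<phi> x) \<le> norm x"
proof -
  have add: "\<phi> (x + y) = \<phi> x + \<phi> y" and mult: "\<phi> (x * y) = \<phi> x * \<phi> y"
    and star: "\<phi> (star x) = star (\<phi> x)" and sc: "\<phi> (r *\<^sub>R x) = r *\<^sub>R \<phi> x" for x y r
    using assms by (auto simp: star_automorphism_def scaleR_scaleC)
  have unit: "norm (\<phi> a) \<le> 1" if a: "star a = a" "norm a < 1" for a
  proof -
    obtain d where "star d = d" "d * a = a * d" "d + d = a * a + d * d"
      using selfadjoint_cosine_has_sine[OF a] .
    with a(1) have "star (\<phi> a) = \<phi> a" "star (\<phi> d) = \<phi> d"
      "\<phi> d * \<phi> a = \<phi> a * \<phi> d" "\<phi> d + \<phi> d = \<phi> a * \<phi> a + \<phi> d * \<phi> d"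
      by (simp_all flip: add mult star)
    then show ?thesis by (rule norm_le_one_if_sine)
  qed
  have sa: "norm (\<phi> a) \<le> norm a" if "star a = a" for a
  proof (rule field_le_epsilon)
    fix e :: real assume "0 < e"
    define t where "t = norm a + e"
    have t: "0 < t" "norm a < t" using \<open>0 < e\<close> by (auto simp: t_def add_nonneg_pos)
    then have "norm (\<phi> ((1 / t) *\<^sub>R a)) \<le> 1"
      by (intro unit) (simp_all add: star_scaleR that)
    then show "norm (\<phi> a) \<le> norm a + e"
      using t by (simp add: sc field_simps) (simp add: t_def)
  qed
  have "(norm (\<phi> x))\<^sup>2 = norm (\<phi> (star x * x))"
    by (simp add: mult star cstar_identity)
  also have "\<dots> \<le> norm (star x * x)"
    by (rule sa) (simp add: star_mult star_star)
  finally show ?thesis by (simp add: cstar_identity)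
qed

lemma star_automorphism_continuous_on:
  fixes \<phi> :: "'a::cstar_algebra \<Rightarrow> 'a"
  assumes "star_automorphism \<phi>"
  shows "continuous_on S \<phi>"
proof -
  have "\<phi> (x + y) = \<phi> x + \<phi> y" and "\<phi> (r *\<^sub>R x) = r *\<^sub>R \<phi> x" for x y r
    using assms by (auto simp: star_automorphism_def scaleR_scaleC)
  then have "bounded_linear \<phi>"
    using star_automorphism_norm_le[OF assms] by (intro bounded_linear_intro[of _ 1]) auto
  then show ?thesis
    by (intro linear_continuous_on)
qed

lemma closed_ideal_vimage:
  fixes \<phi> :: "'a::cstar_algebra \<Rightarrow> 'a"
  assumes "star_automorphism \<phi>" and "closed_ideal I"
  shows "closed_ideal (\<phi> -` I)"
proof -
  have "\<phi> 0 + \<phi> 0 = \<phi> 0"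
    using assms(1) unfolding star_automorphism_def by (metis add_0)
  then have "\<phi> 0 = 0" by simp
  moreover have "closed (\<phi> -` I)"
    using star_automorphism_continuous_on[OF assms(1)] assms(2)
    by (intro closed_vimage) (auto simp: closed_ideal_def)
  ultimately show ?thesis
    using assms by (simp add: closed_ideal_def star_automorphism_def)
qed

section \<open>Projections moved along a connected group\<close>

text \<open>
  With \<open>d = p - q\<close>, idempotence of \<open>p\<close> gives \<open>p = p q + p d\<close>. Inserting this equation into its own
  last term again and again yields \<open>p = (p q + p q d + \<dots> + p q d\<^sup>n\<^sup>-\<^sup>1) + p d\<^sup>n\<close>: the bracket lies
  in the ideal, and the remainder tends to \<open>0\<close>. So \<open>p\<close> is a limit of elements of the ideal.
\<close>

lemma idempotent_in_ideal_if_close: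
  fixes p q :: "'a::cstar_algebra"
  assumes I: "closed_ideal I" and p: "p * p = p" and q: "q \<in> I" and close: "norm (p - q) < 1"
  shows "p \<in> I"
proof -
  define d where "d = p - q"
  \<comment> \<open>\<open>rem n\<close> is \<open>p d\<^sup>n\<close>, written as an iteration because \<open>d\<^sup>0\<close> needs a unit.\<close>
  define rem where "rem n = ((\<lambda>y. y * d) ^^ n) p" for n
  have "p - rem n \<in> I" for n
  proof (induction n)
    case 0
    then show ?case using I by (simp add: rem_def closed_ideal_def)
  next
    case (Suc n)
    have "p - rem (Suc n) = (p - rem n) * d + p * q"
      by (simp add: rem_def d_def algebra_simps p)
    then show ?case
      using Suc I q by (simp add: closed_ideal_def)
  qed
  moreover have "rem \<longlonglongrightarrow> 0"
  proof (rule Lim_null_comparison)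
    have "norm (rem n) \<le> norm p * norm d ^ n" for n
    proof (induction n)
      case (Suc n)
      have "norm (rem (Suc n)) \<le> norm (rem n) * norm d"
        by (simp add: rem_def norm_mult_ineq)
      also have "\<dots> \<le> norm p * norm d ^ n * norm d"
        using Suc by (intro mult_right_mono) auto
      finally show ?case by (simp add: mult_ac)
    qed (simp add: rem_def)
    then show "\<forall>\<^sub>F n in sequentially. norm (rem n) \<le> norm p * norm d ^ n" by simp
    show "(\<lambda>n. norm p * norm d ^ n) \<longlonglongrightarrow> 0"
      using close by (intro tendsto_mult_right_zero LIMSEQ_power_zero) (simp add: d_def)
  qed
  then have "(\<lambda>n. p - rem n) \<longlonglongrightarrow> p - 0"
    by (intro tendsto_intros)
  ultimately show ?thesis
    using I closed_sequentially[of I "\<lambda>n. p - rem n" p] by (simp add: closed_ideal_def)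
qed

text \<open>
  The group elements that keep \<open>p\<close> in \<open>I\<close> form a closed set, since \<open>I\<close> is closed, and an open
  one, since nearby group elements move \<open>p\<close> to nearby idempotents.
\<close>

lemma orbit_of_idempotent_in_ideal:
  fixes \<alpha> :: "'g::topological_group_add \<Rightarrow> 'a::cstar_algebra \<Rightarrow> 'a"
  assumes conn: "connected (UNIV :: 'g set)" and act: "continuous_action \<alpha>"
    and I: "closed_ideal I" and p: "p * p = p" "p \<in> I"
  shows "\<alpha> g p \<in> I"
proof -
  let ?S = "{g. \<alpha> g p \<in> I}"
  have cont: "continuous_on UNIV (\<lambda>g. \<alpha> g p)" and auto: "\<And>g. star_automorphism (\<alpha> g)"
    using act by (auto simp: continuous_action_def)
  have "closed ?S"
    using closed_vimage[OF _ cont, of I] I by (simp add: closed_ideal_def vimage_def)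
  moreover have "open ?S"
  proof (subst open_subopen, rule ballI)
    fix g assume g: "g \<in> ?S"
    let ?T = "{h. norm (\<alpha> h p - \<alpha> g p) < 1}"
    have "open ?T"
      by (intro open_Collect_less continuous_intros cont)
    moreover have "?T \<subseteq> ?S"
    proof
      fix h assume "h \<in> ?T"
      moreover have "\<alpha> h p * \<alpha> h p = \<alpha> h p"
        using auto[of h] p(1) unfolding star_automorphism_def by metis
      ultimately show "h \<in> ?S"
        using g idempotent_in_ideal_if_close[OF I] by auto
    qed
    ultimately show "\<exists>T. open T \<and> g \<in> T \<and> T \<subseteq> ?S" by (intro exI[of _ ?T]) auto
  qed
  ultimately have "?S = {} \<or> ?S = UNIV"
    using conn by (metis connected_clopen open_openin closed_closedin subtopology_UNIV)
  \<comment> \<open>\<open>\<alpha> 0\<close> is an injective idempotent map, hence the identity.\<close>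
  moreover have "\<alpha> 0 p = p"
  proof -
    have "\<alpha> 0 (\<alpha> 0 p) = \<alpha> 0 p"
      using act unfolding continuous_action_def by (metis add_0 comp_apply)
    moreover have "inj (\<alpha> 0)"
      using auto[of 0] by (simp add: star_automorphism_def bij_is_inj)
    ultimately show ?thesis by (simp add: inj_eq)
  qed
  then have "0 \<in> ?S" using p by simp
  ultimately show ?thesis by blast
qed

theorem corollary4p4:
  assumes "connected (UNIV :: 'g::{topological_group_add, t2_space} set)"
    and "ideal_property TYPE('a::cstar_algebra)"
    and "\<exists>\<alpha> :: 'g \<Rightarrow> 'a \<Rightarrow> 'a. continuous_action \<alpha> \<and> minimal_action \<alpha>"
  shows "simple_cstar TYPE('a)"
  unfolding simple_cstar_def
proof (intro allI impI)
  fix I :: "'a set" assume I: "closed_ideal I"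
  obtain \<alpha> :: "'g \<Rightarrow> 'a \<Rightarrow> 'a" where act: "continuous_action \<alpha>" and min: "minimal_action \<alpha>"
    using assms(3) by blast
  \<comment> \<open>The preimage of \<open>I\<close> is a closed ideal containing the projections that generate \<open>I\<close>.\<close>
  have "\<alpha> g ` I \<subseteq> I" for g
  proof -
    have "closed_ideal (\<alpha> g -` I)"
      using act I by (intro closed_ideal_vimage) (auto simp: continuous_action_def)
    moreover have "{p \<in> I. projection p} \<subseteq> \<alpha> g -` I"
      using orbit_of_idempotent_in_ideal[OF assms(1) act I] by (auto simp: projection_def)
    ultimately have "closed_ideal_generated {p \<in> I. projection p} \<subseteq> \<alpha> g -` I"
      by (auto simp: closed_ideal_generated_def)
    moreover have "I = closed_ideal_generated {p \<in> I. projection p}"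
      using assms(2) I by (simp add: ideal_property_def)
    ultimately show ?thesis by blast
  qed
  then show "I = {0} \<or> I = UNIV"
    using min I by (simp add: minimal_action_def)
qed

end
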